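(* Let $k\geq 1$ and $n\geq 4k-1$ be integers such that $k\cdot n$ is even, and let $G$ be a graph of order $n$. If $\rho(G)>\rho(H_{n,k})$, where $H_{n,k}=K_{k-1}\nabla(K_{1}\cup K_{n-k})$, then $G$ contains a $k$-factor.
   Context: All graphs are finite, simple and undirected (not necessarily connected). The order of a graph is its number of vertices. For a graph $G$ with adjacency matrix $A(G)$, the spectral radius $\rho(G)$ is the largest eigenvalue of $A(G)$. $K_m$ is the complete graph on $m$ vertices ($K_0$ is the graph with no vertices, so $H_{n,1}=K_1\cup K_{n-1}$), $\cup$ denotes the disjoint union of graphs, and $G_1\nabla G_2$ denotes the join, obtained from the disjoint union of $G_1$ and $G_2$ by adding all edges between $V(G_1)$ and $V(G_2)$. A $k$-factor of a graph $G$ is a spanning subgraph $H$ of $G$ such that every vertex has degree exactly $k$ in $H$. *)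

theory Defs
  imports "Graph_Theory.Graph_Theory" "Jordan_Normal_Form.Spectral_Radius"
begin

text \<open>
  A finite simple undirected graph is a \<^locale>\<open>pair_graph\<close>: a finite set of vertices with a
  symmetric and irreflexive set of arcs. An undirected edge $uv$ is the pair of arcs
  $(u,v)$, $(v,u)$, so the degree of a vertex is its \<^const>\<open>out_degree\<close>.
\<close>

definition complete_graph :: "nat \<Rightarrow> nat pair_pre_digraph" where
  "complete_graph m = \<lparr> pverts = {..<m}, parcs = {(u, v). u < m \<and> v < m \<and> u \<noteq> v} \<rparr>"

definition disjoint_union ::
    "'a pair_pre_digraph \<Rightarrow> 'b pair_pre_digraph \<Rightarrow> ('a + 'b) pair_pre_digraph" where
  "disjoint_union G H = \<lparr> pverts = pverts G <+> pverts H,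
     parcs = {(Inl u, Inl v) | u v. (u, v) \<in> parcs G} \<union> {(Inr u, Inr v) | u v. (u, v) \<in> parcs H} \<rparr>"

definition graph_join ::
    "'a pair_pre_digraph \<Rightarrow> 'b pair_pre_digraph \<Rightarrow> ('a + 'b) pair_pre_digraph" where
  "graph_join G H = \<lparr> pverts = pverts (disjoint_union G H),
     parcs = parcs (disjoint_union G H)
       \<union> (Inl ` pverts G) \<times> (Inr ` pverts H) \<union> (Inr ` pverts H) \<times> (Inl ` pverts G) \<rparr>"

text \<open>Truncated subtraction is harmless for $1 \le k \le n$.\<close>

definition H_graph :: "nat \<Rightarrow> nat \<Rightarrow> (nat + nat + nat) pair_pre_digraph" where
  "H_graph n k = graph_join (complete_graph (k - 1))
     (disjoint_union (complete_graph 1) (complete_graph (n - k)))"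

text \<open>
  Matrices are indexed by natural numbers, so the adjacency matrix is taken with respect to an
  enumeration of the vertices. Different enumerations give permutation similar matrices; their
  eigenvalues agree.
\<close>

definition vertex_list :: "'a pair_pre_digraph \<Rightarrow> 'a list" where
  "vertex_list G = (SOME vs. distinct vs \<and> set vs = pverts G)"

definition adjacency_matrix :: "'a pair_pre_digraph \<Rightarrow> real mat" where
  "adjacency_matrix G = mat (card (pverts G)) (card (pverts G))
     (\<lambda>(i, j). if (vertex_list G ! i, vertex_list G ! j) \<in> parcs G then 1 else 0)"

text \<open>
  \<^const>\<open>spectral_radius\<close> is the largest modulus of a complex eigenvalue. The following is
  the largest eigenvalue of the adjacency matrix, which is real symmetric. It is meaningful
  only for graphs with at least one vertex.
\<close>

definition graph_spectral_radius :: "'a pair_pre_digraph \<Rightarrow> real" where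
  "graph_spectral_radius G = Max (spectrum (adjacency_matrix G))"

text \<open>
  \<^const>\<open>spanning\<close> alone would admit subdigraphs containing only one of the two arcs of an
  edge; hence the requirement that the factor is again an undirected graph.
\<close>

definition is_k_factor :: "nat \<Rightarrow> 'a pair_pre_digraph \<Rightarrow> 'a pair_pre_digraph \<Rightarrow> bool" where
  "is_k_factor k F G \<longleftrightarrow> pair_graph F \<and> spanning F G \<and> (\<forall>v \<in> pverts F. out_degree F v = k)"

lemma complete_digraph_complete_graph: "complete_digraph m (complete_graph m)"
proof -
  have "complete_digraph m (with_proj (complete_graph m))"
    unfolding complete_digraph_pair_def by (auto simp: complete_graph_def)
  then show ?thesis .
qed

lemma pair_graph_complete_graph: "pair_graph (complete_graph m)"
  by unfold_locales (auto simp: complete_graph_def symmetric_def intro: symI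
      finite_subset[of _ "{..<m} \<times> {..<m}"])

lemma pair_graph_disjoint_union:
  assumes "pair_graph G" "pair_graph H"
  shows "pair_graph (disjoint_union G H)"
proof -
  interpret G: pair_graph G by fact
  interpret H: pair_graph H by fact
  have parcs: "parcs (disjoint_union G H)
      = map_prod Inl Inl ` parcs G \<union> map_prod Inr Inr ` parcs H"
    by (auto simp: disjoint_union_def)
  have "sym (parcs G)" "sym (parcs H)"
    using G.pair_sym_arcs H.pair_sym_arcs by (simp_all add: symmetric_def)
  then have "sym (parcs (disjoint_union G H))"
    unfolding disjoint_union_def sym_def by auto
  then show ?thesis
    by unfold_locales
      (auto simp: parcs symmetric_def disjoint_union_def[of G H, THEN arg_cong[where f = pverts]]
        G.pair_finite_verts H.pair_finite_verts G.pair_finite_arcs H.pair_finite_arcs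
        dest: G.wellformed' H.wellformed' G.pair_no_loops H.pair_no_loops)
qed

lemma pair_graph_graph_join:
  assumes "pair_graph G" "pair_graph H"
  shows "pair_graph (graph_join G H)"
proof -
  interpret G: pair_graph G by fact
  interpret H: pair_graph H by fact
  interpret U: pair_graph "disjoint_union G H"
    using assms by (rule pair_graph_disjoint_union)
  have verts: "pverts (graph_join G H) = pverts G <+> pverts H"
    "pverts (disjoint_union G H) = pverts G <+> pverts H"
    by (simp_all add: graph_join_def disjoint_union_def)
  have parcs: "parcs (graph_join G H) = parcs (disjoint_union G H)
       \<union> (Inl ` pverts G) \<times> (Inr ` pverts H) \<union> (Inr ` pverts H) \<times> (Inl ` pverts G)"
    by (simp add: graph_join_def)
  have "sym (parcs (disjoint_union G H))"
    using U.pair_sym_arcs by (simp add: symmetric_def)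
  then have "sym (parcs (graph_join G H))"
    unfolding parcs sym_def by auto
  moreover have "fst e \<in> pverts G <+> pverts H" "snd e \<in> pverts G <+> pverts H"
    if "e \<in> parcs (disjoint_union G H)" for e
    using that U.arc_fst_in_verts U.arc_snd_in_verts verts by auto
  ultimately show ?thesis
    by unfold_locales
      (auto simp: parcs verts symmetric_def G.pair_finite_verts H.pair_finite_verts
        U.pair_finite_arcs dest: U.pair_no_loops)
qed

lemma pair_graph_H_graph: "pair_graph (H_graph n k)"
  unfolding H_graph_def
  by (intro pair_graph_graph_join pair_graph_disjoint_union pair_graph_complete_graph)

lemma card_verts_H_graph:
  assumes "1 \<le> k" "k \<le> n"
  shows "card (pverts (H_graph n k)) = n"
  using assms
  by (simp add: H_graph_def graph_join_def disjoint_union_def complete_graph_def card_Plus)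

end

theory Submission
  imports Defs "HOL-Analysis.Function_Topology"
begin

text \<open>
  Let $v$ be a vertex of minimum degree $d$. If $d < k$, then $G$ is isomorphic to a spanning
  subgraph of $H_{n,k}$, so $\rho(G) \le \rho(H_{n,k})$. Hence $d \ge k$. As $H_{n,k}$ contains
  $K_{n-1}$, $\rho(G) > n-2$, and the row sums of $A^2 - (d-1)A$ then show that $G$ misses so few
  edges that its complement $C$ has fewer than $d$ arcs away from $v$.

  Fix any $k$ neighbours of $v$ and start with a $k$-regular graph on $V(G)$ in which these are the
  neighbours of $v$. Forbid the edges of $C - v$ one at a time: if a newly forbidden edge $uw$ is
  used, some edge $xy$ of the current $k$-regular graph allows $uw, xy$ to be replaced by $ux, wy$.
  Such an edge exists when $2k + \deg_C u + \deg_C w < n$, by counting the blocked arcs, and this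
  inequality follows from the bound on $C$.
\<close>

section \<open>Regular graphs avoiding a sparse graph\<close>

definition regular_on :: "'a set \<Rightarrow> nat \<Rightarrow> 'a rel \<Rightarrow> bool" where
  "regular_on V k F \<longleftrightarrow> F \<subseteq> V \<times> V \<and> sym F \<and> irrefl F \<and> (\<forall>x \<in> V. card (F `` {x}) = k)"

text \<open>This is the connection set of a circulant graph: the \<open>k div 2\<close> residues
  closest to 0 on either side. For odd \<open>k\<close> one more element is needed; then
  \<open>n\<close> is even, and \<open>n div 2\<close> is its own negative modulo
  \<open>n\<close>.\<close>

lemma symmetric_residue_set:
  assumes "k < n" and "even (k * n)"
  obtains S where "S \<subseteq> {1..<n}" "card S = k" "\<And>d. d \<in> S \<Longrightarrow> n - d \<in> S"
proof -
  define m where "m = k div 2"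
  define S where "S = {1..m} \<union> {n - m..<n}"
  have m: "2 * m < n"
    using assms(1) by (simp add: m_def)
  have "{1..m} \<inter> {n - m..<n} = {}"
    using m by auto
  then have "card S = 2 * m"
    using m by (simp add: S_def card_Un_disjoint)
  then have S: "S \<subseteq> {1..<n}" "card S = 2 * m" "\<And>d. d \<in> S \<Longrightarrow> n - d \<in> S"
    using m by (auto simp: S_def)
  show thesis
  proof (cases "even k")
    case True
    then show thesis
      using that[of S] S by (simp add: m_def)
  next
    case False
    then obtain h where h: "n = 2 * h"
      using assms(2) by auto
    have k: "k = Suc (2 * m)"
      using False by (simp add: m_def)
    have "h \<notin> S" "finite S" "h \<in> {1..<n}"
      using m by (auto simp: S_def h)
    moreover have "n - d \<in> insert h S" if "d \<in> insert h S" for d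
      using that S(3)[of d] by (auto simp: h)
    ultimately show thesis
      using that[of "insert h S"] S(1,2) by (simp add: k)
  qed
qed

text \<open>The circulant graph on the residues modulo \<open>n\<close> works. Closure of
  \<open>S\<close> under negation makes it symmetric, the absence of 0 from \<open>S\<close> makes
  it loop-free, and injectivity of translation gives degree \<open>card S\<close>.\<close>

lemma regular_on_lessThan:
  assumes "k < n" and "even (k * n)"
  obtains F where "regular_on {..<n} k F"
proof -
  obtain S where S: "S \<subseteq> {1..<n}" "card S = k" "\<And>d. d \<in> S \<Longrightarrow> n - d \<in> S"
    using symmetric_residue_set[OF assms] by blast
  define F where "F = {(i, j). i < n \<and> (\<exists>d \<in> S. j = (i + d) mod n)}"
  have "(j, i) \<in> F" if ij: "(i, j) \<in> F" for i j
  proof -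
    obtain d where d: "i < n" "d \<in> S" "j = (i + d) mod n"
      using ij by (auto simp: F_def)
    then have "(j + (n - d)) mod n = (i + d + (n - d)) mod n"
      by (simp add: mod_add_left_eq)
    also have "\<dots> = i"
      using d S(1) by (auto simp: subset_iff)
    finally show ?thesis
      using d S(3)[OF d(2)] by (auto simp: F_def intro!: bexI[of _ "n - d"])
  qed
  then have "sym F"
    by (auto intro: symI)
  \<comment> \<open>Injectivity is stated on all residues rather than on \<open>S\<close>, so that
    an element of \<open>S\<close> can be compared with 0: this excludes loops below.\<close>
  moreover have inj: "inj_on (\<lambda>d. (i + d) mod n) {..<n}" if "i < n" for i
  proof (rule inj_onI)
    fix c d assume "c \<in> {..<n}" "d \<in> {..<n}" "(i + c) mod n = (i + d) mod n"
    then show "c = d"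
      using that by (auto simp: mod_if split: if_splits)
  qed
  have "irrefl F"
  proof (rule irreflI)
    fix i show "(i, i) \<notin> F"
    proof
      assume "(i, i) \<in> F"
      then obtain d where "i < n" "d \<in> S" "i = (i + d) mod n"
        by (auto simp: F_def)
      with inj_onD[OF inj, of i d 0] S(1) show False
        by (auto simp: subset_iff)
    qed
  qed
  moreover have "card (F `` {i}) = k" if "i < n" for i
  proof -
    have "F `` {i} = (\<lambda>d. (i + d) mod n) ` S"
      using that by (auto simp: F_def)
    moreover have "inj_on (\<lambda>d. (i + d) mod n) S"
      using inj[OF that] by (rule inj_on_subset) (use S(1) in auto)
    ultimately show ?thesis
      using S(2) by (simp add: card_image)
  qed
  moreover have "F \<subseteq> {..<n} \<times> {..<n}"
    by (auto simp: F_def)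
  ultimately show thesis
    using that[of F] by (simp add: regular_on_def)
qed

text \<open>Three bijections are glued: on the point, on the subset, and on the rest. It serves
  twice, to relabel a circulant graph around \<open>v\<close> and to place a graph with a vertex of
  small degree inside \<open>H_graph\<close>.\<close>

lemma bij_betw_point_subset:
  assumes "finite V" "finite W" "card V = card W"
    and "v \<in> V" "w \<in> W" "R \<subseteq> V - {v}" "Q \<subseteq> W - {w}" "card R = card Q"
  obtains f where "bij_betw f V W" "f v = w" "f ` R = Q"
proof -
  have fin: "finite R" "finite Q"
    using assms finite_subset[of R V] finite_subset[of Q W] by auto
  then obtain g where g: "bij_betw g R Q"
    using assms(8) finite_same_card_bij by blast
  have "card (V - {v} - R) = card (W - {w} - Q)"
    using assms fin by (simp add: card_Diff_subset)
  then obtain h where h: "bij_betw h (V - {v} - R) (W - {w} - Q)"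
    using assms(1,2) finite_same_card_bij by (metis finite_Diff)
  define f where "f x = (if x = v then w else if x \<in> R then g x else h x)" for x
  have "bij_betw f {v} {w}"
    by (simp add: f_def bij_betw_def)
  moreover have fR: "bij_betw f R Q"
    using g by (rule bij_betw_cong[THEN iffD1, rotated]) (use assms(6) in \<open>auto simp: f_def\<close>)
  moreover have "bij_betw f (V - {v} - R) (W - {w} - Q)"
    using h by (rule bij_betw_cong[THEN iffD1, rotated]) (auto simp: f_def)
  ultimately have "bij_betw f ({v} \<union> R \<union> (V - {v} - R)) ({w} \<union> Q \<union> (W - {w} - Q))"
    using assms(7) by (intro bij_betw_combine) auto
  moreover have "{v} \<union> R \<union> (V - {v} - R) = V" "{w} \<union> Q \<union> (W - {w} - Q) = W"
    using assms by auto
  ultimately have "bij_betw f V W"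
    by simp
  then show thesis
    using that[of f] bij_betw_imp_surj_on[OF fR] by (simp add: f_def)
qed

text \<open>A circulant graph is pulled back along a bijection that sends \<open>v\<close> to 0 and
  \<open>R\<close> onto the neighbours of 0.\<close>

lemma regular_on_neighbourhood:
  assumes "finite V" "k < card V" "even (k * card V)" "v \<in> V" "R \<subseteq> V - {v}" "card R = k"
  obtains F where "regular_on V k F" "F `` {v} = R"
proof -
  let ?n = "card V"
  obtain E where E: "regular_on {..<?n} k E"
    using regular_on_lessThan[OF assms(2,3)] .
  have "0 < ?n"
    using assms(2) by simp
  moreover have "E `` {0} \<subseteq> {..<?n} - {0}"
    using E by (auto simp: regular_on_def irrefl_def)
  moreover have "card R = card (E `` {0})"
    using E assms(6) \<open>0 < ?n\<close> by (auto simp: regular_on_def)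
  ultimately obtain f where f: "bij_betw f V {..<?n}" "f v = 0" "f ` R = E `` {0}"
    using bij_betw_point_subset[of V "{..<?n}" v 0 R "E `` {0}"] assms by auto
  have inj: "inj_on f V" and im: "f ` V = {..<?n}"
    using f(1) by (auto simp: bij_betw_def)
  define F where "F = {(x, y). x \<in> V \<and> y \<in> V \<and> (f x, f y) \<in> E}"
  have nbh: "f ` (F `` {x}) = E `` {f x}" if "x \<in> V" for x
  proof
    show "f ` (F `` {x}) \<subseteq> E `` {f x}"
      by (auto simp: F_def)
    show "E `` {f x} \<subseteq> f ` (F `` {x})"
    proof
      fix j assume j: "j \<in> E `` {f x}"
      then have "j \<in> f ` V"
        using E im by (auto simp: regular_on_def)
      then show "j \<in> f ` (F `` {x})"
        using j that by (auto simp: F_def)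
    qed
  qed
  have "card (F `` {x}) = k" if "x \<in> V" for x
  proof -
    have "inj_on f (F `` {x})"
      by (rule inj_on_subset[OF inj]) (auto simp: F_def)
    then have "card (F `` {x}) = card (E `` {f x})"
      using nbh[OF that] by (metis card_image)
    then show ?thesis
      using E im that by (auto simp: regular_on_def)
  qed
  moreover have "F \<subseteq> V \<times> V" "sym F" "irrefl F"
    using E by (auto simp: F_def regular_on_def sym_def irrefl_def)
  moreover have "F `` {v} = R"
    using inj_on_image_eq_iff[OF inj, of "F `` {v}" R] nbh[OF assms(4)] f assms(5)
    by (auto simp: F_def)
  ultimately show thesis
    using that[of F] by (simp add: regular_on_def)
qed


section \<open>Switching edges away from forbidden pairs\<close>

lemma card_arcs_from_le:
  assumes "finite X" and "\<And>x. x \<in> X \<Longrightarrow> finite (F `` {x}) \<and> card (F `` {x}) \<le> k"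
  shows "card {(x, y) \<in> F. x \<in> X} \<le> k * card X"
proof -
  have "{(x, y) \<in> F. x \<in> X} = Sigma X (\<lambda>x. F `` {x})"
    by auto
  then have "card {(x, y) \<in> F. x \<in> X} = (\<Sum>x \<in> X. card (F `` {x}))"
    using assms by (simp add: card_SigmaI)
  also have "\<dots> \<le> (\<Sum>x \<in> X. k)"
    using assms(2) by (intro sum_mono) auto
  finally show ?thesis
    by (simp add: mult.commute)
qed

lemma card_arcs_to_le:
  assumes "sym F" "finite Y" and "\<And>y. y \<in> Y \<Longrightarrow> finite (F `` {y}) \<and> card (F `` {y}) \<le> k"
  shows "card {(x, y) \<in> F. y \<in> Y} \<le> k * card Y"
proof -
  have "{(x, y) \<in> F. y \<in> Y} = prod.swap ` {(x, y) \<in> F. x \<in> Y}"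
    using assms(1) by (auto simp: sym_def image_iff)
  then show ?thesis
    using card_arcs_from_le[OF assms(2,3)] by (simp add: card_image)
qed

lemma regular_on_card:
  assumes "finite V" "regular_on V k F"
  shows "card F = k * card V"
proof -
  have "F = Sigma V (\<lambda>x. F `` {x})"
    using assms(2) by (auto simp: regular_on_def)
  moreover have "finite (F `` {x})" for x
    using assms finite_subset[of "F `` {x}" V] by (auto simp: regular_on_def)
  ultimately have "card F = (\<Sum>x \<in> V. card (F `` {x}))"
    using assms(1) by (metis card_SigmaI)
  then show ?thesis
    using assms(2) by (simp add: regular_on_def)
qed

text \<open>
  In the application $A$ and $B$ are the forbidden neighbourhoods of $u$ and $w$; replacing $uw$
  and $xy$ by $ux$ and $wy$ keeps all degrees. Since $uw$ is itself an edge, the arcs $(x,u)$ and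
  $(w,y)$ would be counted from both ends; this overlap gives exactly the room that $n \ge 4k-1$
  requires.
\<close>

lemma exists_switching_arc:
  assumes "finite V" "regular_on V k F" "v \<in> V" "(u, w) \<in> F" "u \<noteq> v" "w \<noteq> v"
    and "finite A" "finite B" "2 * k + card A + card B + 2 < card V"
  obtains x y where "(x, y) \<in> F" "x \<noteq> v" "y \<noteq> v"
    "x \<notin> {u} \<union> F `` {u} \<union> A" "y \<notin> {w} \<union> F `` {w} \<union> B"
proof -
  have reg: "F \<subseteq> V \<times> V" "sym F" "irrefl F" "\<And>x. x \<in> V \<Longrightarrow> card (F `` {x}) = k"
    using assms(2) by (auto simp: regular_on_def)
  have uw: "u \<in> V" "w \<in> V" "(w, u) \<in> F"
    using reg(1) assms(4) symD[OF reg(2) assms(4)] by auto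
  have fin: "finite F" "finite (F `` {x})" for x
    using reg(1) assms(1) finite_subset[of F "V \<times> V"] by (auto simp: finite_Image)
  have le: "finite (F `` {x}) \<and> card (F `` {x}) \<le> k" for x
  proof (cases "x \<in> V")
    case False
    then have "F `` {x} = {}"
      using reg(1) by auto
    then show ?thesis by simp
  qed (use reg fin in auto)
  \<comment> \<open>The sets \<open>P1\<close>, \<open>P2\<close>, \<open>P3\<close>,
    \<open>P5\<close>, \<open>P6\<close>, \<open>Q\<close> cover the arcs that are unfit for the
    switching: \<open>x\<close> adjacent to \<open>u\<close>, \<open>y\<close> adjacent to
    \<open>w\<close>, \<open>x = u\<close> or \<open>y = w\<close>, \<open>x\<close> in
    \<open>A\<close>, \<open>y\<close> in \<open>B\<close>, and an end at \<open>v\<close>.\<close>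
  define P1 where "P1 = {(x, y) \<in> F. x \<in> F `` {u}}"
  define P2 where "P2 = {(x, y) \<in> F - F `` {w} \<times> {w} - {w} \<times> F `` {w}. y \<in> F `` {w} - {u}}"
  \<comment> \<open>\<open>P2\<close> leaves out the arcs at \<open>w\<close>: they lie in \<open>P1\<close>, since \<open>w\<close> is a neighbour of \<open>u\<close>, or in \<open>P3\<close>.\<close>
  define P3 where "P3 = {u} \<times> F `` {u} \<union> (F `` {w} - {u}) \<times> {w}"
  define P5 where "P5 = {(x, y) \<in> F. x \<in> A}"
  define P6 where "P6 = {(x, y) \<in> F. y \<in> B}"
  define Q where "Q = {(x, y) \<in> F. x \<in> {v}} \<union> {(x, y) \<in> F. y \<in> {v}}"
  have k: "1 \<le> k"
    using reg(4)[OF uw(1)] fin(2)[of u] assms(4) by (metis Image_singleton_iff card_0_eq empty_iff less_one linorder_not_le)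
  have "card P1 \<le> k * k"
    using card_arcs_from_le[of "F `` {u}" F k] le fin reg(4)[OF uw(1)] by (simp add: P1_def)
  \<comment> \<open>Besides \<open>u\<close>, the vertex \<open>w\<close> has \<open>k - 1\<close>
    neighbours, and each of them loses the arc from \<open>w\<close>. This replaces the crude bound
    \<open>k * k\<close>.\<close>
  moreover have "card P2 \<le> (k - 1) * (k - 1)"
  proof -
    let ?E = "F - F `` {w} \<times> {w} - {w} \<times> F `` {w}"
    have "sym ?E"
      using reg(2) by (auto simp: sym_def)
    moreover have "finite (?E `` {y}) \<and> card (?E `` {y}) \<le> k - 1" if "y \<in> F `` {w} - {u}" for y
    proof -
      have "?E `` {y} \<subseteq> F `` {y} - {w}"
        using that by auto
      then have "card (?E `` {y}) \<le> card (F `` {y} - {w})"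
        using fin by (intro card_mono) auto
      also have "\<dots> = card (F `` {y}) - 1"
        using that symD[OF reg(2), of w y] fin by (subst card_Diff_singleton) auto
      also have "\<dots> \<le> k - 1"
        using le[of y] diff_le_mono by blast
      finally show ?thesis
        using fin(1) by (auto intro: finite_Image)
    qed
    ultimately have "card P2 \<le> (k - 1) * card (F `` {w} - {u})"
      unfolding P2_def using fin by (intro card_arcs_to_le) auto
    also have "card (F `` {w} - {u}) = k - 1"
      using reg(4)[OF uw(2)] uw fin by (subst card_Diff_singleton) auto
    finally show ?thesis .
  qed
  moreover have "card P3 \<le> k + (k - 1)"
  proof -
    have "card (F `` {w} - {u}) = k - 1"
      using reg(4)[OF uw(2)] uw fin by (subst card_Diff_singleton) auto
    moreover have "card ({u} \<times> F `` {u}) = k"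
      using reg(4)[OF uw(1)] by (simp add: card_cartesian_product)
    ultimately show ?thesis
      using card_Un_le[of "{u} \<times> F `` {u}" "(F `` {w} - {u}) \<times> {w}"]
      by (simp add: P3_def card_cartesian_product)
  qed
  moreover have "card P5 \<le> k * card A" "card P6 \<le> k * card B"
    unfolding P5_def P6_def using assms(7,8) le reg(2)
    by (auto intro!: card_arcs_from_le card_arcs_to_le)
  moreover have "card Q \<le> k + k"
  proof -
    have "card {(x, y) \<in> F. x \<in> {v}} \<le> k * card {v}" "card {(x, y) \<in> F. y \<in> {v}} \<le> k * card {v}"
      using le reg(2) by (intro card_arcs_from_le card_arcs_to_le; simp)+
    then show ?thesis
      unfolding Q_def using card_Un_le[of "{(x, y) \<in> F. x \<in> {v}}" "{(x, y) \<in> F. y \<in> {v}}"] by simp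
  qed
  moreover have "card (P1 \<union> P2 \<union> P3 \<union> P5 \<union> P6 \<union> Q)
      \<le> card P1 + card P2 + card P3 + card P5 + card P6 + card Q"
    by (meson card_Un_le add_right_mono order_trans)
  ultimately have "card (P1 \<union> P2 \<union> P3 \<union> P5 \<union> P6 \<union> Q)
      \<le> k * k + (k - 1) * (k - 1) + (k + (k - 1)) + k * card A + k * card B + (k + k)"
    by linarith
  \<comment> \<open>Here \<open>k * k + (k - 1) * (k - 1) + (2 * k - 1)\<close> collapses to
    \<open>2 * k * k\<close>, so the whole bound is a multiple of \<open>k\<close> and can be
    compared with \<open>card F = k * card V\<close>.\<close>
  also have "\<dots> = k * (2 * k + card A + card B + 2)"
  proof -
    obtain m where "k = Suc m"
      using k by (cases k) auto
    then show ?thesis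
      by (simp add: algebra_simps)
  qed
  also have "\<dots> < card F"
    unfolding regular_on_card[OF assms(1,2)] using assms(9) k by (intro mult_strict_left_mono) auto
  finally have "card (P1 \<union> P2 \<union> P3 \<union> P5 \<union> P6 \<union> Q) < card F" .
  moreover have "finite (P1 \<union> P2 \<union> P3 \<union> P5 \<union> P6 \<union> Q)"
  proof (rule finite_subset)
    show "P1 \<union> P2 \<union> P3 \<union> P5 \<union> P6 \<union> Q \<subseteq> F \<union> P3"
      by (auto simp: P1_def P2_def P5_def P6_def Q_def)
    show "finite (F \<union> P3)"
      using fin by (auto simp: P3_def)
  qed
  ultimately have "\<not> F \<subseteq> P1 \<union> P2 \<union> P3 \<union> P5 \<union> P6 \<union> Q"
    by (meson card_mono leD)
  then obtain x y where xy: "(x, y) \<in> F" "(x, y) \<notin> P1 \<union> P2 \<union> P3 \<union> P5 \<union> P6 \<union> Q"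
    by auto
  have "x \<notin> F `` {u}" "x \<noteq> u" "x \<notin> A" "y \<notin> B" "x \<noteq> v" "y \<noteq> v"
    using xy by (auto simp: P1_def P3_def P5_def P6_def Q_def)
  moreover from this have "x \<noteq> w" "y \<noteq> u"
    using assms(4) symD[OF reg(2) xy(1)] by auto
  \<comment> \<open>Because \<open>P2\<close> omits the arcs at \<open>w\<close> and the arcs into
    \<open>u\<close>, the inequalities \<open>x \<noteq> w\<close>, \<open>y \<noteq> u\<close> and
    \<open>y \<noteq> w\<close> must come before the conclusion that \<open>y\<close> is not
    adjacent to \<open>w\<close>.\<close>
  moreover have "y \<noteq> w"
    using xy \<open>x \<noteq> u\<close> symD[OF reg(2) xy(1)] by (auto simp: P3_def)
  moreover from calculation have "y \<notin> F `` {w}"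
    using xy by (auto simp: P2_def)
  ultimately show thesis
    using that[of x y] xy(1) by blast
qed

text \<open>The four endpoints are distinct, since \<open>x = w\<close> or \<open>y = u\<close>
  would contradict the non-adjacency assumptions. Each of them loses one neighbour and gains one
  that it did not have.\<close>

lemma regular_on_switch:
  assumes "finite V" "regular_on V k F"
    and "(u, w) \<in> F" "(x, y) \<in> F" "x \<notin> {u} \<union> F `` {u}" "y \<notin> {w} \<union> F `` {w}"
  defines "E \<equiv> F - {(u, w), (w, u), (x, y), (y, x)} \<union> {(u, x), (x, u), (w, y), (y, w)}"
  shows "regular_on V k E"
proof -
  have reg: "F \<subseteq> V \<times> V" "sym F" "irrefl F" "\<And>z. z \<in> V \<Longrightarrow> card (F `` {z}) = k"
    using assms(2) by (auto simp: regular_on_def)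
  have arcs: "(w, u) \<in> F" "(y, x) \<in> F" "(u, x) \<notin> F" "(x, u) \<notin> F" "(w, y) \<notin> F" "(y, w) \<notin> F"
    using symD[OF reg(2)] assms(3-6) by blast+
  have ne: "x \<noteq> u" "y \<noteq> w" "x \<noteq> w" "y \<noteq> u" "u \<noteq> w" "x \<noteq> y"
    using reg(3) assms(3-6) arcs by (auto simp: irrefl_def)
  have "card (E `` {z}) = k" if "z \<in> V" for z
  proof -
    have swap: "card (insert b (F `` {z} - {a})) = k" if "a \<in> F `` {z}" "b \<notin> F `` {z}" for a b
    proof -
      have "finite (F `` {z})"
        using reg(1) assms(1) finite_subset[of "F `` {z}" V] by auto
      moreover from this have "0 < card (F `` {z})"
        using that(1) by (auto simp: card_gt_0_iff)
      ultimately show ?thesis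
        using that reg(4)[OF \<open>z \<in> V\<close>] by simp
    qed
    consider "z = u" | "z = w" | "z = x" | "z = y" | "z \<notin> {u, w, x, y}"
      by auto
    then show ?thesis
    proof cases
      case 1
      then have "E `` {z} = insert x (F `` {z} - {w})"
        using ne by (auto simp: E_def)
      then show ?thesis using swap[of w x] assms(3) arcs 1 by auto
    next
      case 2
      then have "E `` {z} = insert y (F `` {z} - {u})"
        using ne by (auto simp: E_def)
      then show ?thesis using swap[of u y] arcs 2 by auto
    next
      case 3
      then have "E `` {z} = insert u (F `` {z} - {y})"
        using ne by (auto simp: E_def)
      then show ?thesis using swap[of y u] assms(4) arcs 3 by auto
    next
      case 4
      then have "E `` {z} = insert w (F `` {z} - {x})"
        using ne by (auto simp: E_def)
      then show ?thesis using swap[of x w] arcs 4 by auto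
    next
      case 5
      then have "E `` {z} = F `` {z}"
        by (auto simp: E_def)
      then show ?thesis using reg(4) that by simp
    qed
  qed
  moreover have "E \<subseteq> V \<times> V" "sym E" "irrefl E"
    using reg(1-3) assms(3,4) ne by (auto simp: E_def sym_def irrefl_def)
  ultimately show ?thesis
    by (simp add: regular_on_def)
qed

text \<open>Induction on the forbidden relation: one edge is set aside, the rest is avoided by
  induction, and a single switching repairs the remaining edge if it is used. The degree condition
  passes to subrelations, and the neighbourhood of \<open>v\<close> survives because no switching
  touches \<open>v\<close>.\<close>

lemma regular_on_avoiding:
  assumes "finite V" "k < card V" "even (k * card V)" "v \<in> V" "R \<subseteq> V - {v}" "card R = k"
    and "finite C" "sym C" "C \<subseteq> (V - {v}) \<times> (V - {v})"
    and "\<And>u w. (u, w) \<in> C \<Longrightarrow> 2 * k + card (C `` {u}) + card (C `` {w}) < card V"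
  shows "\<exists>F. regular_on V k F \<and> F `` {v} = R \<and> F \<inter> C = {}"
  using assms(7-10)
proof (induction C rule: finite_psubset_induct)
  case (psubset C)
  show ?case
  proof (cases "C = {}")
    case True
    then show ?thesis
      using regular_on_neighbourhood[OF assms(1-6)] by (metis inf_bot_right)
  next
    case False
    then obtain u w where uw: "(u, w) \<in> C"
      by auto
    then have wu: "(w, u) \<in> C"
      using psubset.prems(1) by (blast dest: symD)
    define D where "D = C - {(u, w), (w, u)}"
    have "2 * k + card (D `` {a}) + card (D `` {b}) < card V" if "(a, b) \<in> D" for a b
    proof -
      have "card (D `` {z}) \<le> card (C `` {z})" for z
        using psubset.hyps by (intro card_mono) (auto simp: D_def finite_Image)
      then have "2 * k + card (D `` {a}) + card (D `` {b}) \<le> 2 * k + card (C `` {a}) + card (C `` {b})"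
        by (simp add: add_mono)
      moreover have "(a, b) \<in> C"
        using that by (simp add: D_def)
      ultimately show ?thesis
        using psubset.prems(3) by (meson le_less_trans)
    qed
    moreover have "D \<subset> C" "sym D" "D \<subseteq> (V - {v}) \<times> (V - {v})"
      using uw psubset.prems by (auto simp: D_def sym_def)
    ultimately obtain F where F: "regular_on V k F" "F `` {v} = R" "F \<inter> D = {}"
      using psubset.IH[of D] by auto
    have symF: "sym F"
      using F(1) by (simp add: regular_on_def)
    show ?thesis
    proof (cases "(u, w) \<in> F")
      case False
      then have "F \<inter> C = {}"
        using F(3) symD[OF symF, of w u] by (auto simp: D_def)
      then show ?thesis
        using F by blast
    next
      case True
      \<comment> \<open>Removing \<open>w\<close> and \<open>u\<close> lowers each cardinality by
        one, which pays for the \<open>+ 2\<close> in \<open>exists_switching_arc\<close>. Nothing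
        is lost: \<open>x \<noteq> w\<close> and \<open>y \<noteq> u\<close> hold anyway, as
        \<open>u\<close> and \<open>w\<close> are adjacent in \<open>F\<close>.\<close>
      let ?A = "C `` {u} - {w}" and ?B = "C `` {w} - {u}"
      have fin: "finite (C `` {z})" for z
        using psubset.hyps by (simp add: finite_Image)
      have "0 < card (C `` {u})" "0 < card (C `` {w})"
        using fin uw wu by (auto simp: card_gt_0_iff)
      then have "2 * k + card ?A + card ?B + 2 < card V"
        using psubset.prems(3)[OF uw] uw wu fin by (simp add: card_Diff_singleton)
      moreover have "u \<noteq> v" "w \<noteq> v"
        using uw psubset.prems(2) by auto
      ultimately obtain x y where xy: "(x, y) \<in> F" "x \<noteq> v" "y \<noteq> v"
          "x \<notin> {u} \<union> F `` {u} \<union> ?A" "y \<notin> {w} \<union> F `` {w} \<union> ?B"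
        using exists_switching_arc[OF assms(1) F(1) assms(4) True, of ?A ?B] fin by blast
      define E where "E = F - {(u, w), (w, u), (x, y), (y, x)} \<union> {(u, x), (x, u), (w, y), (y, w)}"
      have "regular_on V k E"
        unfolding E_def using xy by (intro regular_on_switch[OF assms(1) F(1) True]) auto
      moreover have "E `` {v} = R"
        using F(2) xy \<open>u \<noteq> v\<close> \<open>w \<noteq> v\<close> by (auto simp: E_def)
      moreover have "x \<noteq> w" "y \<noteq> u"
        using xy True symD[OF symF True] by auto
      then have "(u, x) \<notin> C" "(w, y) \<notin> C"
        using xy by auto
      then have "E \<inter> C = {}"
        using F(3) symD[OF psubset.prems(1), of x u] symD[OF psubset.prems(1), of y w]
        by (auto simp: E_def D_def)
      ultimately show ?thesis
        by blast
    qed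
  qed
qed

section \<open>The largest adjacency eigenvalue\<close>

text \<open>Compactness of the unit sphere. Vectors are functions on \<open>nat\<close> whose
  coordinates from \<open>n\<close> on are pinned to 0, so the sphere is a closed subset of a
  product of compact sets.\<close>

lemma quadratic_form_attains_max:
  fixes a :: "nat \<Rightarrow> nat \<Rightarrow> real"
  assumes "0 < n"
  obtains x where "(\<Sum>i<n. x i ^ 2) = 1"
    "\<And>y. (\<Sum>i<n. y i ^ 2) = 1 \<Longrightarrow>
      (\<Sum>i<n. \<Sum>j<n. a i j * y i * y j) \<le> (\<Sum>i<n. \<Sum>j<n. a i j * x i * x j)"
proof -
  define B where "B = (\<Pi>\<^sub>E i\<in>UNIV. if i < n then {-1..1} else {0 :: real})"
  define S where "S = B \<inter> {x. (\<Sum>i<n. x i ^ 2) = 1}"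
  have coord [continuous_intros]: "continuous_on A (\<lambda>x :: nat \<Rightarrow> real. x i)" for A i
    by (rule continuous_on_product_then_coordinatewise) (rule continuous_on_id)
  have "compactin (product_topology (\<lambda>i. euclidean) UNIV) B"
    unfolding B_def compactin_PiE by auto
  then have "compact B"
    by (simp add: euclidean_product_topology)
  moreover have "closed {x :: nat \<Rightarrow> real. (\<Sum>i<n. x i ^ 2) = 1}"
    by (intro closed_Collect_eq continuous_intros)
  ultimately have "compact S"
    unfolding S_def by blast
  moreover have "(\<lambda>i. if i = 0 then 1 else 0) \<in> S"
    using assms by (auto simp: S_def B_def PiE_def if_distrib[of "\<lambda>t. t ^ 2"] cong: if_cong)
  then have "S \<noteq> {}"
    by auto
  moreover have "continuous_on S (\<lambda>x. \<Sum>i<n. \<Sum>j<n. a i j * x i * x j)"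
    by (intro continuous_intros)
  ultimately obtain x where x: "x \<in> S"
      "\<forall>y\<in>S. (\<Sum>i<n. \<Sum>j<n. a i j * y i * y j) \<le> (\<Sum>i<n. \<Sum>j<n. a i j * x i * x j)"
    using continuous_attains_sup by blast
  show thesis
  proof (rule that)
    show "(\<Sum>i<n. x i ^ 2) = 1"
      using x(1) by (simp add: S_def)
    fix y :: "nat \<Rightarrow> real" assume y: "(\<Sum>i<n. y i ^ 2) = 1"
    define z where "z i = (if i < n then y i else 0)" for i
    have "y i ^ 2 \<le> 1" if "i < n" for i
      using member_le_sum[of i "{..<n}" "\<lambda>i. y i ^ 2"] that y by auto
    then have "\<bar>y i\<bar> \<le> 1" if "i < n" for i
      using that by (simp add: abs_square_le_1)
    then have "z i \<in> (if i < n then {-1..1} else {0})" for i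
      by (auto simp: z_def abs_le_iff minus_le_iff)
    then have "z \<in> S"
      using y by (simp add: S_def B_def PiE_def Pi_def) (simp add: z_def)
    then show "(\<Sum>i<n. \<Sum>j<n. a i j * y i * y j) \<le> (\<Sum>i<n. \<Sum>j<n. a i j * x i * x j)"
      using x(2)[rule_format, of z] by (simp add: z_def)
  qed
qed

text \<open>By homogeneity the maximum on the sphere bounds the form everywhere. Perturbing a single
  coordinate of the maximiser then shows that the first-order term vanishes, which is the eigenvalue
  equation in that coordinate.\<close>

lemma symmetric_form_max_eigenvector:
  fixes a :: "nat \<Rightarrow> nat \<Rightarrow> real"
  assumes "0 < n" and sym: "\<And>i j. i < n \<Longrightarrow> j < n \<Longrightarrow> a i j = a j i"
  obtains x \<mu> where "(\<Sum>i<n. x i ^ 2) = 1" "\<And>i. i < n \<Longrightarrow> (\<Sum>j<n. a i j * x j) = \<mu> * x i"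
    "\<And>y. (\<Sum>i<n. \<Sum>j<n. a i j * y i * y j) \<le> \<mu> * (\<Sum>i<n. y i ^ 2)"
proof -
  define Q where "Q y = (\<Sum>i<n. \<Sum>j<n. a i j * y i * y j)" for y
  define N where "N y = (\<Sum>i<n. y i ^ 2)" for y :: "nat \<Rightarrow> real"
  obtain x where x: "N x = 1" "\<And>y. N y = 1 \<Longrightarrow> Q y \<le> Q x"
    unfolding Q_def N_def by (rule quadratic_form_attains_max[OF assms(1), of a]) blast
  have max: "Q y \<le> Q x * N y" for y
  proof (cases "N y = 0")
    case True
    then have "\<forall>i<n. y i = 0"
      by (simp add: N_def sum_nonneg_eq_0_iff)
    then show ?thesis
      using True by (simp add: Q_def)
  next
    case False
    then have pos: "0 < N y"
      by (simp add: N_def less_le sum_nonneg)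
    define c where "c = inverse (sqrt (N y))"
    have c: "c ^ 2 = inverse (N y)"
      using pos by (simp add: c_def power_inverse)
    have "N (\<lambda>i. c * y i) = c ^ 2 * N y"
      by (simp add: N_def power_mult_distrib sum_distrib_left)
    moreover have "Q (\<lambda>i. c * y i) = c ^ 2 * Q y"
      by (simp add: Q_def sum_distrib_left power2_eq_square mult_ac)
    ultimately have "inverse (N y) * Q y \<le> Q x"
      using x(2)[of "\<lambda>i. c * y i"] pos c by simp
    then show ?thesis
      using pos by (simp add: field_simps)
  qed
  have eig: "(\<Sum>j<n. a i j * x j) = Q x * x i" if "i < n" for i
  proof -
    define d where "d = (\<Sum>j<n. a i j * x j) - Q x * x i"
    \<comment> \<open>The global bound is evaluated at \<open>x\<close> with \<open>t\<close> added
      to coordinate \<open>i\<close>; the constant terms cancel.\<close>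
    have quad: "2 * t * d \<le> t ^ 2 * (Q x - a i i)" for t
    proof -
      define e where "e j = (if j = i then t else 0)" for j
      have sum_e: "(\<Sum>j<n. f j * e j) = f i * t" for f
        using that by (simp add: e_def if_distrib[of "\<lambda>s. _ * s"] cong: if_cong)
      have expand: "a k j * (x k + e k) * (x j + e j) = a k j * x k * x j + (a k j * x k) * e j
          + (a k j * x j) * e k + (a k j * e j) * e k" for k j
        by (simp add: algebra_simps)
      have "Q (\<lambda>j. x j + e j) = (\<Sum>k<n. \<Sum>j<n. a k j * x k * x j) + (\<Sum>k<n. (\<Sum>j<n. (a k j * x k) * e j))
          + (\<Sum>k<n. (\<Sum>j<n. a k j * x j) * e k) + (\<Sum>k<n. (\<Sum>j<n. a k j * e j) * e k)"
        unfolding Q_def expand by (simp only: sum.distrib sum_distrib_right)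
      also have "\<dots> = Q x + (\<Sum>k<n. a k i * x k) * t + (\<Sum>j<n. a i j * x j) * t + a i i * t * t"
        unfolding sum_e Q_def by (simp add: sum_distrib_right)
      also have "(\<Sum>k<n. a k i * x k) = (\<Sum>k<n. a i k * x k)"
        using sym that by (intro sum.cong) auto
      finally have 1: "Q (\<lambda>j. x j + e j) = Q x + 2 * t * (\<Sum>k<n. a i k * x k) + a i i * t ^ 2"
        by (simp add: power2_eq_square)
      have "N (\<lambda>j. x j + e j) = N x + 2 * (\<Sum>k<n. x k * e k) + (\<Sum>k<n. e k * e k)"
        unfolding N_def by (simp add: power2_eq_square algebra_simps sum.distrib sum_distrib_left)
      also have "\<dots> = 1 + 2 * (x i * t) + t ^ 2"
        using x(1) by (simp add: sum_e) (simp add: e_def power2_eq_square)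
      finally have 2: "N (\<lambda>j. x j + e j) = 1 + 2 * (x i * t) + t ^ 2" .
      show ?thesis
        using max[of "\<lambda>j. x j + e j"] unfolding 1 2 d_def by (simp add: algebra_simps)
    qed
    have "d = 0"
    proof (rule ccontr)
      assume "d \<noteq> 0"
      \<comment> \<open>The choice makes \<open>c\<close> positive and larger than
        \<open>Q x - a i i\<close>, so \<open>t = d / c\<close> turns the inequality into
        \<open>2 * d^2 / c \<le> d^2 / c\<close>.\<close>
      define c where "c = \<bar>Q x - a i i\<bar> + 1"
      have c: "0 < c" "Q x - a i i < c"
        by (auto simp: c_def)
      have "2 * (d / c) * d \<le> (d / c) ^ 2 * (Q x - a i i)"
        by (rule quad)
      also have "\<dots> \<le> (d / c) ^ 2 * c"
        using c by (intro mult_left_mono) auto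
      also have "\<dots> = (d / c) * d"
        using c by (simp add: power2_eq_square)
      finally have "d ^ 2 / c \<le> 0"
        by (simp add: power2_eq_square)
      then show False
        using c \<open>d \<noteq> 0\<close> by (simp add: divide_le_0_iff)
    qed
    then show ?thesis
      by (simp add: d_def)
  qed
  show thesis
    using that[of x "Q x"] x(1) eig max by (simp add: Q_def N_def)
qed

text \<open>The maximum of the Rayleigh quotient is itself an eigenvalue, and every eigenvalue is
  the Rayleigh quotient of its eigenvector, so this maximum is
  \<open>Max (spectrum A)\<close>.\<close>

lemma spectrum_symmetric_real_mat:
  fixes A :: "real mat"
  assumes "A \<in> carrier_mat n n" "0 < n" and sym: "\<And>i j. i < n \<Longrightarrow> j < n \<Longrightarrow> A $$ (i, j) = A $$ (j, i)"
  obtains x where "(\<Sum>i<n. x i ^ 2) = 1"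
    "\<And>i. i < n \<Longrightarrow> (\<Sum>j<n. A $$ (i, j) * x j) = Max (spectrum A) * x i"
    "\<And>y. (\<Sum>i<n. \<Sum>j<n. A $$ (i, j) * y i * y j) \<le> Max (spectrum A) * (\<Sum>i<n. y i ^ 2)"
proof -
  obtain x \<mu> where x: "(\<Sum>i<n. x i ^ 2) = 1" "\<And>i. i < n \<Longrightarrow> (\<Sum>j<n. A $$ (i, j) * x j) = \<mu> * x i"
    "\<And>y. (\<Sum>i<n. \<Sum>j<n. A $$ (i, j) * y i * y j) \<le> \<mu> * (\<Sum>i<n. y i ^ 2)"
    by (rule symmetric_form_max_eigenvector[OF assms(2), of "\<lambda>i j. A $$ (i, j)"]) (use sym in auto)
  have fin: "finite (spectrum A)"
    using card_finite_spectrum[OF assms(1)] by simp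
  have mult_vec: "(A *\<^sub>v v) $ i = (\<Sum>j<n. A $$ (i, j) * v $ j)" if "v \<in> carrier_vec n" "i < n" for v i
    using that assms(1) by (auto simp: scalar_prod_def atLeast0LessThan intro!: sum.cong)
  have "\<mu> \<in> spectrum A"
  proof -
    have "vec n x \<noteq> 0\<^sub>v n"
    proof
      assume "vec n x = 0\<^sub>v n"
      then have "x i = 0" if "i < n" for i
        using that by (metis index_vec index_zero_vec(1))
      then show False
        using x(1) by simp
    qed
    moreover have "A *\<^sub>v vec n x = \<mu> \<cdot>\<^sub>v vec n x"
      using x(2) assms(1) by (intro eq_vecI) (auto simp del: index_mult_mat_vec simp add: mult_vec)
    ultimately have "eigenvector A (vec n x) \<mu>"
      using assms(1) by (auto simp: eigenvector_def)
    then show ?thesis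
      by (auto simp: spectrum_def eigenvalue_def)
  qed
  moreover have "\<nu> \<le> \<mu>" if \<nu>: "\<nu> \<in> spectrum A" for \<nu>
  proof -
    obtain v where "eigenvector A v \<nu>"
      using \<nu> by (auto simp: spectrum_def eigenvalue_def)
    then have v: "v \<in> carrier_vec n" "v \<noteq> 0\<^sub>v n" "A *\<^sub>v v = \<nu> \<cdot>\<^sub>v v"
      using assms(1) by (auto simp: eigenvector_def)
    have eig: "(\<Sum>j<n. A $$ (i, j) * v $ j) = \<nu> * v $ i" if "i < n" for i
      using mult_vec[OF v(1) that] v that by auto
    have "\<nu> * (\<Sum>i<n. v $ i ^ 2) = (\<Sum>i<n. v $ i * (\<Sum>j<n. A $$ (i, j) * v $ j))"
      using eig by (simp add: sum_distrib_left power2_eq_square mult_ac)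
    also have "\<dots> = (\<Sum>i<n. \<Sum>j<n. A $$ (i, j) * v $ i * v $ j)"
      by (simp add: sum_distrib_left mult_ac)
    also have "\<dots> \<le> \<mu> * (\<Sum>i<n. v $ i ^ 2)"
      by (rule x(3))
    finally have "\<nu> * (\<Sum>i<n. v $ i ^ 2) \<le> \<mu> * (\<Sum>i<n. v $ i ^ 2)" .
    moreover have "0 < (\<Sum>i<n. v $ i ^ 2)"
    proof -
      obtain i where "i < n" "v $ i \<noteq> 0"
        using v(1,2) by (metis carrier_vecD eq_vecI index_zero_vec)
      then show ?thesis
        by (intro sum_pos2[of _ i]) auto
    qed
    ultimately show ?thesis
      by simp
  qed
  ultimately have "Max (spectrum A) = \<mu>"
    using fin by (intro Max_eqI)
  then show thesis
    using that[of x] x by simp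
qed


section \<open>Spectral radius and the edges of a graph\<close>

text \<open>Sums over indices become sums over vertices and arcs; later arguments use only these
  three facts and never the enumeration behind \<open>adjacency_matrix\<close>.\<close>

lemma graph_spectral_radius_eigenvector:
  fixes G :: "'a pair_pre_digraph"
  assumes "pair_graph G" "pverts G \<noteq> {}"
  obtains x where "(\<Sum>v\<in>pverts G. x v ^ 2) = 1"
    "\<And>v. v \<in> pverts G \<Longrightarrow> (\<Sum>w\<in>parcs G `` {v}. x w) = graph_spectral_radius G * x v"
    "\<And>y. (\<Sum>(u, w)\<in>parcs G. y u * y w) \<le> graph_spectral_radius G * (\<Sum>v\<in>pverts G. y v ^ 2)"
proof -
  interpret pair_graph G by fact
  let ?V = "pverts G" and ?E = "parcs G"
  define vs where "vs = vertex_list G"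
  define n where "n = card ?V"
  let ?A = "adjacency_matrix G"
  have "\<exists>vs. distinct vs \<and> set vs = ?V"
    using finite_distinct_list[OF pair_finite_verts] by blast
  then have vs: "distinct vs" "set vs = ?V"
    unfolding vs_def vertex_list_def by (metis (mono_tags, lifting) someI_ex)+
  then have len: "length vs = n"
    using distinct_card by (fastforce simp: n_def)
  have bij: "bij_betw (\<lambda>i. vs ! i) {..<n} ?V"
    using vs len by (intro bij_betw_nth) auto
  have reindex: "(\<Sum>v\<in>?V. f v) = (\<Sum>i<n. f (vs ! i))" for f :: "'a \<Rightarrow> real"
    using sum.reindex_bij_betw[OF bij, of f] by simp
  have A: "?A $$ (i, j) = (if (vs ! i, vs ! j) \<in> ?E then 1 else 0)" if "i < n" "j < n" for i j
    using that by (simp add: adjacency_matrix_def vs_def n_def)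
  have EV: "?E \<subseteq> ?V \<times> ?V"
    using wellformed' by auto
  have row: "(\<Sum>j<n. ?A $$ (i, j) * f (vs ! j)) = (\<Sum>w\<in>?E `` {vs ! i}. f w)"
    if "i < n" for i and f :: "'a \<Rightarrow> real"
  proof -
    have "(\<Sum>j<n. ?A $$ (i, j) * f (vs ! j)) = (\<Sum>w\<in>?V. if w \<in> ?E `` {vs ! i} then f w else 0)"
      unfolding reindex using that by (intro sum.cong) (auto simp: A)
    also have "\<dots> = (\<Sum>w\<in>?E `` {vs ! i}. f w)"
      using EV by (intro sum.mono_neutral_cong_right) auto
    finally show ?thesis .
  qed
  have carrier: "?A \<in> carrier_mat n n"
    by (simp add: adjacency_matrix_def n_def)
  have "0 < n"
    using assms(2) by (simp add: n_def card_gt_0_iff)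
  have sym: "?A $$ (i, j) = ?A $$ (j, i)" if "i < n" "j < n" for i j
    using that arcs_symmetric by (auto simp: A)
  obtain z where z: "(\<Sum>i<n. z i ^ 2) = 1"
      "\<And>i. i < n \<Longrightarrow> (\<Sum>j<n. ?A $$ (i, j) * z j) = graph_spectral_radius G * z i"
      "\<And>y. (\<Sum>i<n. \<Sum>j<n. ?A $$ (i, j) * y i * y j) \<le> graph_spectral_radius G * (\<Sum>i<n. y i ^ 2)"
    unfolding graph_spectral_radius_def
    by (rule spectrum_symmetric_real_mat[OF carrier \<open>0 < n\<close> sym]) blast+
  define x where "x v = z (the_inv_into {..<n} (\<lambda>i. vs ! i) v)" for v
  have x: "x (vs ! i) = z i" if "i < n" for i
    using bij that by (simp add: x_def bij_betw_def the_inv_into_f_f)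
  show thesis
  proof (rule that)
    show "(\<Sum>v\<in>?V. x v ^ 2) = 1"
      using z(1) by (simp add: reindex x)
  next
    fix v assume "v \<in> ?V"
    then obtain i where i: "i < n" "v = vs ! i"
      using bij by (auto simp: bij_betw_def)
    have "(\<Sum>w\<in>?E `` {v}. x w) = (\<Sum>j<n. ?A $$ (i, j) * z j)"
      using row[OF i(1), of x] by (simp add: i(2) x)
    then show "(\<Sum>w\<in>?E `` {v}. x w) = graph_spectral_radius G * x v"
      using z(2)[OF i(1)] by (simp add: i x)
  next
    fix y :: "'a \<Rightarrow> real"
    have "(\<Sum>(u, w)\<in>?E. y u * y w) = (\<Sum>(u, w)\<in>Sigma ?V (\<lambda>u. ?E `` {u}). y u * y w)"
      using EV by (intro sum.cong) auto
    also have "\<dots> = (\<Sum>u\<in>?V. \<Sum>w\<in>?E `` {u}. y u * y w)"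
      by (subst sum.Sigma) (auto simp: finite_Image)
    also have "\<dots> = (\<Sum>i<n. y (vs ! i) * (\<Sum>w\<in>?E `` {vs ! i}. y w))"
      by (simp add: reindex sum_distrib_left)
    also have "\<dots> = (\<Sum>i<n. \<Sum>j<n. ?A $$ (i, j) * y (vs ! i) * y (vs ! j))"
      by (simp add: row[symmetric] sum_distrib_left mult_ac)
    also have "\<dots> \<le> graph_spectral_radius G * (\<Sum>i<n. y (vs ! i) ^ 2)"
      by (rule z(3))
    finally show "(\<Sum>(u, w)\<in>?E. y u * y w) \<le> graph_spectral_radius G * (\<Sum>v\<in>?V. y v ^ 2)"
      by (simp add: reindex)
  qed
qed

text \<open>The Rayleigh bound for \<open>H\<close> is tested on the absolute values of an
  eigenvector of \<open>G\<close>, carried over by \<open>f\<close>. Absolute values do not decrease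
  the form, and further arcs of \<open>H\<close> contribute nonnegative terms.\<close>

lemma graph_spectral_radius_mono:
  fixes G :: "'a pair_pre_digraph" and H :: "'b pair_pre_digraph"
  assumes "pair_graph G" "pair_graph H" "pverts G \<noteq> {}" "bij_betw f (pverts G) (pverts H)"
    and "\<And>u w. (u, w) \<in> parcs G \<Longrightarrow> (f u, f w) \<in> parcs H"
  shows "graph_spectral_radius G \<le> graph_spectral_radius H"
proof -
  interpret G: pair_graph G by fact
  interpret H: pair_graph H by fact
  let ?V = "pverts G"
  have inj: "inj_on f ?V" and im: "f ` ?V = pverts H"
    using assms(4) by (auto simp: bij_betw_def)
  obtain x where x: "(\<Sum>v\<in>?V. x v ^ 2) = 1"
    "\<And>v. v \<in> ?V \<Longrightarrow> (\<Sum>w\<in>parcs G `` {v}. x w) = graph_spectral_radius G * x v"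
    using graph_spectral_radius_eigenvector[OF assms(1,3)] by metis
  define y where "y v = \<bar>x (the_inv_into ?V f v)\<bar>" for v
  have y: "y (f v) = \<bar>x v\<bar>" if "v \<in> ?V" for v
    using that inj by (simp add: y_def the_inv_into_f_f)
  have "pverts H \<noteq> {}"
    using assms(3) im by auto
  then have max: "(\<Sum>(u, w)\<in>parcs H. y u * y w) \<le> graph_spectral_radius H * (\<Sum>v\<in>pverts H. y v ^ 2)"
    using graph_spectral_radius_eigenvector[OF assms(2)] by metis
  have "graph_spectral_radius G = graph_spectral_radius G * (\<Sum>v\<in>?V. x v ^ 2)"
    using x(1) by simp
  also have "\<dots> = (\<Sum>v\<in>?V. \<Sum>w\<in>parcs G `` {v}. x v * x w)"
    using x(2) by (simp add: sum_distrib_left[symmetric] power2_eq_square mult_ac)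
  also have "\<dots> = (\<Sum>(v, w)\<in>Sigma ?V (\<lambda>v. parcs G `` {v}). x v * x w)"
    by (subst sum.Sigma) (auto simp: finite_Image)
  also have "\<dots> = (\<Sum>(v, w)\<in>parcs G. x v * x w)"
    using G.wellformed' by (intro sum.cong) auto
  also have "\<dots> \<le> (\<Sum>(v, w)\<in>parcs G. y (f v) * y (f w))"
    using G.wellformed' by (intro sum_mono) (auto simp: y abs_mult[symmetric])
  also have "\<dots> = (\<Sum>(v, w)\<in>map_prod f f ` parcs G. y v * y w)"
  proof -
    have "inj_on (map_prod f f) (parcs G)"
      using G.wellformed' by (intro inj_on_subset[OF map_prod_inj_on[OF inj inj]]) auto
    then show ?thesis
      by (simp add: sum.reindex case_prod_unfold)
  qed
  also have "\<dots> \<le> (\<Sum>(u, w)\<in>parcs H. y u * y w)"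
    using assms(5) by (intro sum_mono2) (auto simp: y_def)
  also have "\<dots> \<le> graph_spectral_radius H * (\<Sum>v\<in>pverts H. y v ^ 2)"
    by (rule max)
  also have "(\<Sum>v\<in>pverts H. y v ^ 2) = (\<Sum>v\<in>?V. y (f v) ^ 2)"
    using sum.reindex_bij_betw[OF assms(4), of "\<lambda>v. y v ^ 2"] by simp
  also have "\<dots> = 1"
    using x(1) by (simp add: y)
  finally show ?thesis
    by simp
qed

text \<open>The test vector is the indicator of \<open>W\<close>: the form is at least
  \<open>card W * (card W - 1)\<close> and the squared norm is \<open>card W\<close>.\<close>

lemma graph_spectral_radius_clique:
  assumes "pair_graph G" "W \<subseteq> pverts G" "W \<noteq> {}"
    and "\<And>u w. u \<in> W \<Longrightarrow> w \<in> W \<Longrightarrow> u \<noteq> w \<Longrightarrow> (u, w) \<in> parcs G"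
  shows "real (card W) - 1 \<le> graph_spectral_radius G"
proof -
  interpret pair_graph G by fact
  have fin: "finite W"
    using assms(2) pair_finite_verts finite_subset by blast
  define y where "y v = (if v \<in> W then 1 else 0 :: real)" for v
  have "pverts G \<noteq> {}"
    using assms(2,3) by auto
  then have max: "(\<Sum>(u, w)\<in>parcs G. y u * y w) \<le> graph_spectral_radius G * (\<Sum>v\<in>pverts G. y v ^ 2)"
    using graph_spectral_radius_eigenvector[OF assms(1)] by metis
  have "(real (card W) - 1) * card W = card (Sigma W (\<lambda>u. W - {u}))"
    using fin assms(3) by (subst card_SigmaI) (auto simp: card_Diff_singleton algebra_simps of_nat_diff card_gt_0_iff Suc_leI)
  also have "\<dots> = (\<Sum>(u, w)\<in>Sigma W (\<lambda>u. W - {u}). y u * y w)"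
    unfolding card_eq_sum of_nat_sum by (intro sum.cong) (auto simp: y_def)
  also have "\<dots> \<le> (\<Sum>(u, w)\<in>parcs G. y u * y w)"
    using assms(4) by (intro sum_mono2) (auto simp: y_def)
  also have "\<dots> \<le> graph_spectral_radius G * (\<Sum>v\<in>pverts G. y v ^ 2)"
    by (rule max)
  also have "(\<Sum>v\<in>pverts G. y v ^ 2) = (\<Sum>v\<in>W. 1)"
    using assms(2) by (intro sum.mono_neutral_cong_right) (auto simp: y_def)
  finally show ?thesis
    using fin assms(3) by (simp add: card_gt_0_iff)
qed

text \<open>
  The row sums of $A^2 - (d-1)A$ are at most $2e - (n-1)d$. Instead of a Perron eigenvector it
  suffices to have $y = |x| \ge 0$ with $Ay \ge \rho y$: with $s_i = 1^T A^i y$ one gets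
  $s_2 - (d-1)s_1 \ge (\rho-d+1)s_1 \ge \rho(\rho-d+1)s_0$, because $\rho > n-2 \ge d-1$.
\<close>

lemma graph_spectral_radius_row_sums:
  fixes G :: "'a pair_pre_digraph"
  assumes "pair_graph G" "pverts G \<noteq> {}"
    and min: "\<And>v. v \<in> pverts G \<Longrightarrow> d \<le> card (parcs G `` {v})"
    and "real (card (pverts G)) - 2 < graph_spectral_radius G" "2 \<le> card (pverts G)"
    and "d < card (pverts G)"
  shows "(real (card (pverts G)) - 1) * (real (card (pverts G)) - 2) + real d < real (card (parcs G))"
proof -
  interpret pair_graph G by fact
  let ?V = "pverts G" and ?E = "parcs G"
  define \<rho> where "\<rho> = graph_spectral_radius G"
  define n where "n = real (card ?V)"
  define \<delta> where "\<delta> = real d"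
  obtain x where x: "(\<Sum>v\<in>?V. x v ^ 2) = 1"
    "\<And>v. v \<in> ?V \<Longrightarrow> (\<Sum>w\<in>?E `` {v}. x w) = \<rho> * x v"
    using graph_spectral_radius_eigenvector[OF assms(1,2)] unfolding \<rho>_def by metis
  define y where "y v = \<bar>x v\<bar>" for v
  define deg where "deg v = real (card (?E `` {v}))" for v
  have \<rho>: "0 \<le> \<rho>" "n - 2 < \<rho>" "0 \<le> n - 2" "0 \<le> n - 1 - \<delta>"
    using assms by (auto simp: \<rho>_def n_def \<delta>_def)
  have fin: "finite (?E `` {v})" for v
    by (auto simp: finite_Image)
  have nbh: "?E `` {v} \<subseteq> ?V" for v
    using wellformed' by auto
  have sub: "\<rho> * y v \<le> (\<Sum>w\<in>?E `` {v}. y w)" if "v \<in> ?V" for v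
    using x(2)[OF that] sum_abs[of x "?E `` {v}"] \<rho>(1) by (simp add: y_def abs_mult)
  \<comment> \<open>Symmetry of the adjacency matrix, as the identity between
    \<open>g^T (A h)\<close> and \<open>(A g)^T h\<close>; it moves \<open>A\<close> from
    \<open>y\<close> onto the degree sums.\<close>
  have swap: "(\<Sum>v\<in>?V. g v * (\<Sum>w\<in>?E `` {v}. h w)) = (\<Sum>w\<in>?V. (\<Sum>v\<in>?E `` {w}. g v) * h w)"
    for g h :: "'a \<Rightarrow> real"
  proof -
    have restrict: "(\<Sum>w\<in>?E `` {v}. f w) = (\<Sum>w\<in>?V. if (v, w) \<in> ?E then f w else 0)" for v and f :: "'a \<Rightarrow> real"
      using nbh by (intro sum.mono_neutral_cong_left) auto
    have "(\<Sum>v\<in>?V. g v * (\<Sum>w\<in>?E `` {v}. h w)) = (\<Sum>v\<in>?V. \<Sum>w\<in>?V. if (v, w) \<in> ?E then g v * h w else 0)"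
      by (simp add: restrict sum_distrib_left if_distrib cong: if_cong)
    also have "\<dots> = (\<Sum>w\<in>?V. \<Sum>v\<in>?V. if (v, w) \<in> ?E then g v * h w else 0)"
      by (rule sum.swap)
    also have "\<dots> = (\<Sum>w\<in>?V. \<Sum>v\<in>?V. if (w, v) \<in> ?E then g v * h w else 0)"
      using arcs_symmetric by (intro sum.cong if_cong) auto
    also have "\<dots> = (\<Sum>w\<in>?V. (\<Sum>v\<in>?E `` {w}. g v) * h w)"
      by (simp add: restrict sum_distrib_right if_distrib if_distribR cong: if_cong)
    finally show ?thesis .
  qed
  define s0 where "s0 = (\<Sum>v\<in>?V. y v)"
  define s1 where "s1 = (\<Sum>v\<in>?V. deg v * y v)"
  define s2 where "s2 = (\<Sum>v\<in>?V. (\<Sum>w\<in>?E `` {v}. deg w) * y v)"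
  have "\<rho> * s0 \<le> (\<Sum>v\<in>?V. 1 * (\<Sum>w\<in>?E `` {v}. y w))"
    unfolding s0_def sum_distrib_left using sub by (intro sum_mono) auto
  also have "\<dots> = s1"
    unfolding swap by (simp add: s1_def deg_def)
  finally have s1: "\<rho> * s0 \<le> s1" .
  have "\<rho> * s1 = (\<Sum>v\<in>?V. deg v * (\<rho> * y v))"
    by (simp add: s1_def sum_distrib_left mult_ac)
  also have "\<dots> \<le> (\<Sum>v\<in>?V. deg v * (\<Sum>w\<in>?E `` {v}. y w))"
    using sub by (intro sum_mono mult_left_mono) (auto simp: deg_def)
  also have "\<dots> = s2"
    unfolding swap by (simp add: s2_def)
  finally have s2: "\<rho> * s1 \<le> s2" .
  have total: "(\<Sum>v\<in>?V. deg v) = real (card ?E)"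
  proof -
    have "?E = Sigma ?V (\<lambda>v. ?E `` {v})"
      using wellformed' by auto
    then have "card ?E = (\<Sum>v\<in>?V. card (?E `` {v}))"
      using fin by (metis card_SigmaI pair_finite_verts)
    then show ?thesis
      by (simp add: deg_def)
  qed
  \<comment> \<open>The degree sum \<open>card ?E\<close> is split over \<open>v\<close>, its
    neighbours, and the other \<open>n - 1 - deg v\<close> vertices, each of which has degree at
    least \<open>\<delta>\<close>.\<close>
  have row: "(\<Sum>w\<in>?E `` {v}. deg w) - (\<delta> - 1) * deg v \<le> real (card ?E) - (n - 1) * \<delta>" if v: "v \<in> ?V" for v
  proof -
    let ?R = "?V - {v} - ?E `` {v}"
    have "v \<notin> ?E `` {v}"
      using pair_no_loops[of "(v, v)"] by auto
    then have nbh': "?E `` {v} \<subseteq> ?V - {v}"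
      using nbh by auto
    have split: "(\<Sum>w\<in>?V. f w) = f v + (\<Sum>w\<in>?E `` {v}. f w) + (\<Sum>w\<in>?R. f w)" for f :: "'a \<Rightarrow> real"
      using sum.remove[OF pair_finite_verts v, of f] sum.subset_diff[OF nbh', of f] by simp
    have "real (card ?R) = n - 1 - deg v"
      using split[of "\<lambda>_. 1"] by (simp add: n_def deg_def)
    moreover have "real (card ?R) * \<delta> \<le> (\<Sum>w\<in>?R. deg w)"
      using min by (intro sum_bounded_below) (auto simp: deg_def \<delta>_def)
    ultimately have "real (card ?E) \<ge> deg v + (\<Sum>w\<in>?E `` {v}. deg w) + (n - 1 - deg v) * \<delta>"
      using split[of deg] total by simp
    then show ?thesis
      by (simp add: algebra_simps)
  qed
  have y0: "0 \<le> y v" for v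
    by (simp add: y_def)
  have "0 < s0"
  proof -
    have "\<exists>v\<in>?V. x v \<noteq> 0"
      using x(1) by (rule contrapos_pp) simp
    then obtain v where "v \<in> ?V" "x v \<noteq> 0" by auto
    then show ?thesis
      unfolding s0_def by (intro sum_pos2[of _ v]) (auto simp: y_def)
  qed
  have "\<rho> * (\<rho> - \<delta> + 1) * s0 = (\<rho> - \<delta> + 1) * (\<rho> * s0)"
    by simp
  also have "\<dots> \<le> (\<rho> - \<delta> + 1) * s1"
    using s1 \<rho> by (intro mult_left_mono) auto
  also have "\<dots> \<le> s2 - (\<delta> - 1) * s1"
    using s2 by (simp add: algebra_simps)
  also have "\<dots> = (\<Sum>v\<in>?V. ((\<Sum>w\<in>?E `` {v}. deg w) - (\<delta> - 1) * deg v) * y v)"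
    by (simp add: s1_def s2_def sum_subtractf sum_distrib_left left_diff_distrib mult.assoc)
  also have "\<dots> \<le> (\<Sum>v\<in>?V. (real (card ?E) - (n - 1) * \<delta>) * y v)"
    using row y0 by (intro sum_mono mult_right_mono) auto
  also have "\<dots> = (real (card ?E) - (n - 1) * \<delta>) * s0"
    by (simp add: s0_def sum_distrib_left)
  finally have "\<rho> * (\<rho> - \<delta> + 1) \<le> real (card ?E) - (n - 1) * \<delta>"
    using \<open>0 < s0\<close> by simp
  moreover have "(n - 2) * (n - 1 - \<delta>) < \<rho> * (\<rho> - \<delta> + 1)"
    using \<rho> by (intro mult_strict_mono') auto
  \<comment> \<open>The left side equals \<open>(n - 1) * (n - 2) + \<delta>\<close>.\<close>
  ultimately have "(n - 2) * (n - 1 - \<delta>) + (n - 1) * \<delta> < real (card ?E)"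
    by simp
  then show ?thesis
    by (simp add: n_def \<delta>_def algebra_simps)
qed

section \<open>Factors\<close>

lemma pverts_H_graph:
  "pverts (H_graph n k) = Inl ` {..<k - 1} \<union> {Inr (Inl 0)} \<union> Inr ` Inr ` {..<n - k}"
  by (auto simp: H_graph_def graph_join_def disjoint_union_def complete_graph_def Plus_def)

text \<open>All non-adjacent pairs of distinct vertices involve \<open>Inr (Inl 0)\<close>, the
  vertex of the summand \<open>K_1\<close>, which sees only \<open>K_{k-1}\<close>; hence the two
  conditional assumptions.\<close>

lemma arc_H_graph:
  assumes "x \<in> pverts (H_graph n k)" "y \<in> pverts (H_graph n k)" "x \<noteq> y"
    and "x = Inr (Inl 0) \<Longrightarrow> y \<in> Inl ` {..<k - 1}" "y = Inr (Inl 0) \<Longrightarrow> x \<in> Inl ` {..<k - 1}"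
  shows "(x, y) \<in> parcs (H_graph n k)"
  using assms unfolding pverts_H_graph
  by (auto simp: H_graph_def graph_join_def disjoint_union_def complete_graph_def)

text \<open>Deleting the vertex of \<open>K_1\<close> leaves a clique on \<open>n - 1\<close>
  vertices.\<close>

lemma graph_spectral_radius_H_graph_ge:
  assumes "1 \<le> k" "k \<le> n" "2 \<le> n"
  shows "real n - 2 \<le> graph_spectral_radius (H_graph n k)"
proof -
  let ?W = "pverts (H_graph n k) - {Inr (Inl 0)}"
  have "Inr (Inl 0) \<in> pverts (H_graph n k)"
    by (simp add: pverts_H_graph)
  then have card: "card ?W = n - 1"
    using card_verts_H_graph[OF assms(1,2)] by (simp add: card_Diff_singleton)
  then have "?W \<noteq> {}"
    using assms(3) by (intro notI) simp
  then have "real (card ?W) - 1 \<le> graph_spectral_radius (H_graph n k)"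
    by (intro graph_spectral_radius_clique pair_graph_H_graph) (auto intro: arc_H_graph)
  then show ?thesis
    using card assms(3) by (simp add: of_nat_diff)
qed

text \<open>The vertex \<open>v\<close> goes to the vertex of \<open>K_1\<close>, and a set of
  exactly \<open>k - 1\<close> vertices containing its neighbours goes onto \<open>K_{k-1}\<close>.
  Arcs away from \<open>v\<close> are preserved because the remaining vertices of
  \<open>H_graph\<close> form a clique.\<close>

lemma graph_spectral_radius_le_H_graph:
  assumes "pair_graph G" "1 \<le> k" "k \<le> card (pverts G)" "v \<in> pverts G" "card (parcs G `` {v}) < k"
  shows "graph_spectral_radius G \<le> graph_spectral_radius (H_graph (card (pverts G)) k)"
proof -
  interpret pair_graph G by fact
  let ?V = "pverts G" and ?H = "H_graph (card (pverts G)) k" and ?z = "Inr (Inl 0) :: nat + nat + nat"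
  have "parcs G `` {v} \<subseteq> ?V - {v}"
    using wellformed' pair_no_loops[of "(v, v)"] by auto
  moreover have "card (parcs G `` {v}) \<le> k - 1" "k - 1 \<le> card (?V - {v})"
    using assms by auto
  ultimately obtain R where R: "parcs G `` {v} \<subseteq> R" "R \<subseteq> ?V - {v}" "card R = k - 1"
    by (metis exists_subset_between finite_Diff pair_finite_verts)
  have "card (Inl ` {..<k - 1} :: (nat + nat + nat) set) = k - 1"
    by (simp add: card_image)
  then obtain f where f: "bij_betw f ?V (pverts ?H)" "f v = ?z" "f ` R = Inl ` {..<k - 1}"
    using bij_betw_point_subset[of ?V "pverts ?H" v ?z R "Inl ` {..<k - 1}"]
      R assms(3,4) card_verts_H_graph[OF assms(2,3)] pair_finite_verts
    by (auto simp: pverts_H_graph)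
  show ?thesis
  proof (rule graph_spectral_radius_mono[OF assms(1) pair_graph_H_graph _ f(1)])
    show "?V \<noteq> {}"
      using assms(4) by auto
    fix u w assume uw: "(u, w) \<in> parcs G"
    then have V: "u \<in> ?V" "w \<in> ?V" "u \<noteq> w"
      using wellformed' pair_no_loops[OF uw] by auto
    have inj: "f a = f b \<longleftrightarrow> a = b" if "a \<in> ?V" "b \<in> ?V" for a b
      using f(1) that by (auto simp: bij_betw_def inj_on_eq_iff)
    have "w \<in> R" if "u = v"
      using uw R(1) that by auto
    moreover have "u \<in> R" if "w = v"
      using uw R(1) that arcs_symmetric by auto
    moreover have "f u \<in> pverts ?H" "f w \<in> pverts ?H"
      using f(1) V by (auto simp: bij_betw_def)
    ultimately show "(f u, f w) \<in> parcs ?H"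
      using V f(2,3) inj[of u v] inj[of w v] inj[of u w] assms(4) by (intro arc_H_graph) auto
  qed
qed

section \<open>Missing arcs and the construction of the factor\<close>

text \<open>Ordered pairs of distinct vertices are arcs, non-arcs away from \<open>v\<close>, or
  non-arcs at \<open>v\<close>; the last kind occurs once in each direction.\<close>

lemma card_non_arcs:
  assumes "pair_graph G" "v \<in> pverts G"
  defines "C \<equiv> {(x, y) \<in> (pverts G - {v}) \<times> (pverts G - {v}). x \<noteq> y \<and> (x, y) \<notin> parcs G}"
  shows "card (parcs G) + card C + 2 * (card (pverts G) - 1 - card (parcs G `` {v}))
    = card (pverts G) * (card (pverts G) - 1)"
proof -
  interpret pair_graph G by fact
  let ?V = "pverts G" and ?E = "parcs G"
  define S where "S = ?V - {v} - ?E `` {v}"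
  have fin: "finite S" "finite C" "finite (?E `` {v})"
    by (auto simp: S_def C_def finite_Image intro: finite_subset[of _ "?V \<times> ?V"])
  have no_loop: "(x, x) \<notin> ?E" for x
    using pair_no_loops[of "(x, x)"] by auto
  have "?E `` {v} \<subseteq> ?V - {v}"
    using wellformed' no_loop by auto
  then have S: "card S = card ?V - 1 - card (?E `` {v})"
    using fin assms(2) by (simp add: S_def card_Diff_subset)
  have "Sigma ?V (\<lambda>x. ?V - {x}) = (?E \<union> C) \<union> ({v} \<times> S \<union> S \<times> {v})"
    using wellformed' no_loop arcs_symmetric assms(2) by (auto simp: C_def S_def)
  moreover have "(?E \<union> C) \<inter> ({v} \<times> S \<union> S \<times> {v}) = {}" "?E \<inter> C = {}" "{v} \<times> S \<inter> S \<times> {v} = {}"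
    using arcs_symmetric by (auto simp: C_def S_def)
  ultimately have "card (Sigma ?V (\<lambda>x. ?V - {x})) = card ?E + card C + (card S + card S)"
    using fin by (simp add: card_Un_disjoint card_cartesian_product)
  moreover have "card (Sigma ?V (\<lambda>x. ?V - {x})) = card ?V * (card ?V - 1)"
    by (simp add: card_SigmaI card_Diff_singleton)
  ultimately show ?thesis
    by (simp add: S)
qed

text \<open>Arcs leaving \<open>u\<close> or \<open>w\<close> are counted together with those
  entering from other vertices. The edge between \<open>u\<close> and \<open>w\<close> would appear
  twice, which costs the 2.\<close>

lemma card_ge_two_neighbourhoods:
  assumes "finite C" "sym C" "irrefl C" "(u, w) \<in> C"
  shows "2 * card (C `` {u}) + 2 * card (C `` {w}) \<le> card C + 2"
proof -
  have wu: "(w, u) \<in> C" "u \<noteq> w"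
    using assms(3,4) symD[OF assms(2,4)] by (auto simp: irrefl_def)
  have fin: "finite (C `` {x})" for x
    using assms(1) by (simp add: finite_Image)
  let ?U = "C `` {u}" and ?W = "C `` {w}"
  let ?S = "{u} \<times> ?U \<union> {w} \<times> ?W" and ?T = "(?U - {w}) \<times> {u} \<union> (?W - {u}) \<times> {w}"
  have "card ?S = card ?U + card ?W"
    using fin wu(2) by (subst card_Un_disjoint) (auto simp: card_cartesian_product)
  moreover have "card ?T = (card ?U - 1) + (card ?W - 1)"
    using fin wu assms(4) by (subst card_Un_disjoint) (auto simp: card_cartesian_product card_Diff_singleton)
  moreover have "card (?S \<union> ?T) = card ?S + card ?T"
    using fin wu(2) assms(3) by (intro card_Un_disjoint) (auto simp: irrefl_def)
  moreover have "card (?S \<union> ?T) \<le> card C"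
    using assms(1) by (intro card_mono) (use symD[OF assms(2)] in blast)+
  ultimately show ?thesis
    by arith
qed

lemma is_k_factor_regular_on:
  assumes "pair_graph G" "regular_on (pverts G) k F" "F \<subseteq> parcs G"
  shows "is_k_factor k \<lparr>pverts = pverts G, parcs = F\<rparr> G"
proof -
  interpret G: pair_graph G by fact
  let ?F = "\<lparr>pverts = pverts G, parcs = F\<rparr>"
  have F: "F \<subseteq> pverts G \<times> pverts G" "sym F" "irrefl F"
    using assms(2) by (auto simp: regular_on_def)
  have "finite F"
    using assms(3) G.pair_finite_arcs finite_subset by blast
  then have pair: "pair_graph ?F"
    using F by unfold_locales (auto simp: symmetric_def irrefl_def)
  then interpret F: pair_graph ?F .
  have "out_arcs ?F v = Pair v ` (F `` {v})" for v
    by (auto simp: out_arcs_def)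
  then have "out_degree ?F v = card (F `` {v})" for v
    by (simp add: out_degree_def card_image inj_on_def)
  moreover have "spanning ?F G"
    using assms(3) G.wf_digraph F.wf_digraph by (auto simp: spanning_def subgraph_def compatible_def)
  ultimately show ?thesis
    using pair assms(2) by (simp add: is_k_factor_def regular_on_def)
qed

theorem corollary1p1:
  fixes G :: "'a pair_pre_digraph" and n k :: nat
  assumes "1 \<le> k"
    and "4 * k - 1 \<le> n"
    and "even (k * n)"
    and "pair_graph G"
    and "card (pverts G) = n"
    and "graph_spectral_radius G > graph_spectral_radius (H_graph n k)"
  shows "\<exists>F. is_k_factor k F G"
proof -
  interpret pair_graph G by fact
  let ?V = "pverts G" and ?E = "parcs G"
  have n: "k < n" "3 \<le> n" "4 * k \<le> n + 1"
    using assms(1,2) by auto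
  then have "?V \<noteq> {}"
    using assms(5) by auto
  define d where "d = Min ((\<lambda>v. card (?E `` {v})) ` ?V)"
  have "d \<in> (\<lambda>v. card (?E `` {v})) ` ?V"
    unfolding d_def using \<open>?V \<noteq> {}\<close> by (intro Min_in) auto
  then obtain v where v: "v \<in> ?V" "card (?E `` {v}) = d"
    by auto
  have d_le: "d \<le> card (?E `` {x})" if "x \<in> ?V" for x
    unfolding d_def using that by (intro Min_le) auto
  \<comment> \<open>Otherwise \<open>G\<close> would embed in \<open>H_graph n k\<close>,
    contradicting the strict inequality of the spectral radii.\<close>
  have "k \<le> d"
    using graph_spectral_radius_le_H_graph[OF assms(4,1) _ v(1)] assms(5,6) n v(2) by fastforce
  have no_loop: "(x, x) \<notin> ?E" for x
    using pair_no_loops[of "(x, x)"] by auto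
  have nbh: "?E `` {x} \<subseteq> ?V - {x}" for x
    using wellformed' no_loop by auto
  have "d < n"
    using card_mono[OF _ nbh[of v]] v assms(5) n by simp
  moreover have "real n - 2 < graph_spectral_radius G"
    using graph_spectral_radius_H_graph_ge[of k n] assms(1,6) n by simp
  ultimately have "(real n - 1) * (real n - 2) + real d < real (card ?E)"
    using graph_spectral_radius_row_sums[OF assms(4) \<open>?V \<noteq> {}\<close> d_le] assms(5) n by simp
  then have "real ((n - 1) * (n - 2) + d) < real (card ?E)"
    using n by (simp add: of_nat_diff)
  then have arcs: "(n - 1) * (n - 2) + d < card ?E"
    by (simp only: of_nat_less_iff)
  define C where "C = {(x, y) \<in> (?V - {v}) \<times> (?V - {v}). x \<noteq> y \<and> (x, y) \<notin> ?E}"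
  have "card ?E + card C + 2 * (n - 1 - d) = n * (n - 1)"
    using card_non_arcs[OF assms(4) v(1)] by (simp add: C_def assms(5) v(2))
  moreover have "n * (n - 1) = (n - 1) * (n - 2) + 2 * (n - 1)"
  proof -
    obtain m where "n = 2 + m"
      using n(2) le_Suc_ex[of 2 n] by auto
    then show ?thesis
      by (simp add: algebra_simps)
  qed
  \<comment> \<open>Of the \<open>2 * (n - 1)\<close> pairs beyond \<open>(n - 1) * (n - 2)\<close>,
    more than \<open>d\<close> are arcs and \<open>2 * (n - 1 - d)\<close> are non-arcs at
    \<open>v\<close>, so fewer than \<open>d\<close> remain for \<open>C\<close>.\<close>
  ultimately have "card C < d"
    using arcs \<open>d < n\<close> by linarith
  have C: "finite C" "sym C" "irrefl C" "C \<subseteq> (?V - {v}) \<times> (?V - {v})"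
    using arcs_symmetric by (auto simp: C_def sym_def irrefl_def intro: finite_subset[of _ "?V \<times> ?V"])
  have deg_C: "card (C `` {x}) + d \<le> n - 1" if "x \<in> ?V" for x
  proof -
    have "card (C `` {x}) + card (?E `` {x}) = card (C `` {x} \<union> ?E `` {x})"
      using C(1) by (intro card_Un_disjoint[symmetric]) (auto simp: finite_Image, auto simp: C_def)
    also have "\<dots> \<le> card (?V - {x})"
      using nbh by (intro card_mono) (auto simp: C_def)
    also have "\<dots> = n - 1"
      using that assms(5) by simp
    finally show ?thesis
      using d_le[OF that] by linarith
  qed
  have small: "2 * k + card (C `` {u}) + card (C `` {w}) < card ?V" if uw: "(u, w) \<in> C" for u w
  proof -
    have "w \<in> C `` {u}" "u \<in> C `` {w}"
      using uw symD[OF C(2) uw] by auto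
    then have pos: "0 < card (C `` {u})" "0 < card (C `` {w})"
      using C(1) by (auto simp: card_gt_0_iff finite_Image)
    have le: "card (C `` {u}) + d \<le> n - 1" "card (C `` {w}) + d \<le> n - 1"
      using uw C(4) deg_C by auto
    have sum: "2 * card (C `` {u}) + 2 * card (C `` {w}) \<le> d + 1"
      using card_ge_two_neighbourhoods[OF C(1-3) uw] \<open>card C < d\<close> by linarith
    show ?thesis
    \<comment> \<open>If \<open>d \<le> n - 3\<close>, then \<open>sum\<close> and
      \<open>4 * k \<le> n + 1\<close> add up to twice the goal with no slack. Otherwise
      \<open>deg_C\<close> forces both \<open>C\<close>-degrees to be 1 and
      \<open>d = n - 2\<close>, and \<open>sum\<close> gives \<open>n \<ge> 5\<close>, which settles
      \<open>k = 1\<close>; for larger \<open>k\<close> the bound on \<open>n\<close>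
      suffices.\<close>
    proof (cases "d + 3 \<le> n")
      case True
      then show ?thesis
        using sum n(3) assms(5) by linarith
    next
      case False
      then have "card (C `` {u}) = 1" "card (C `` {w}) = 1" "d + 2 = n"
        using pos le n by linarith+
      moreover from this have "2 * k + 2 < n"
        using sum n assms(1) by (cases "k = 1") linarith+
      ultimately show ?thesis
        using assms(5) by simp
    qed
  qed
  obtain R where R: "R \<subseteq> ?E `` {v}" "card R = k"
    using \<open>k \<le> d\<close> v(2) by (metis obtain_subset_with_card_n)
  have "k < card ?V" "even (k * card ?V)" "R \<subseteq> ?V - {v}"
    using n assms(3,5) R nbh[of v] by auto
  from regular_on_avoiding[OF pair_finite_verts this(1,2) v(1) this(3) R(2) C(1,2,4) small]
  obtain F where F: "regular_on ?V k F" "F `` {v} = R" "F \<inter> C = {}"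
    by auto
  \<comment> \<open>Pairs away from \<open>v\<close> are arcs of \<open>G\<close> because they avoid
    \<open>C\<close>; pairs at \<open>v\<close> are arcs because \<open>R\<close> was chosen among
    the neighbours of \<open>v\<close>.\<close>
  have "(x, y) \<in> ?E" if xy: "(x, y) \<in> F" for x y
  proof -
    have "(y, x) \<in> F" "x \<in> ?V" "y \<in> ?V" "x \<noteq> y"
      using F(1) xy by (auto simp: regular_on_def irrefl_def sym_def)
    then show ?thesis
      using F R(1) xy arcs_symmetric by (cases "x = v"; cases "y = v") (auto simp: C_def)
  qed
  then have "F \<subseteq> ?E"
    by auto
  then show ?thesis
    using is_k_factor_regular_on[OF assms(4) F(1)] by blast
qed

end
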